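(* Let $\mathcal{P}(N)=\{X\in\mathbb{R}^{N\times N}:X^\top=X,\ X\succ0\}$ be the manifold of symmetric positive definite matrices. Given a density $p>0$ and a kernel $\kappa>0$ of class $C^{(1,1)}$ on $\mathcal{P}(N)$, the function $\kappa_p$ is $$\kappa_p(X,Y)=4\langle X\mathscr{S}(\nabla^{\mathbb{R}}_X\log(p\kappa)),Y\mathscr{S}(\nabla^{\mathbb{R}}_Y\log(p\kappa))\rangle_F\,\kappa(X,Y)+\sum_{i,j}K^{ij}_YK^{ij}_X\log\kappa\cdot\kappa(X,Y).$$ Furthermore, if $\kappa(X,Y)=e^{-\psi(\|X-Y\|_F^2)}$ is a radial kernel for some $\psi\in C^2[0,+\infty)$, then $$\begin{aligned}\kappa_p(X,Y)&=4\langle X\mathscr{S}(\nabla^{\mathbb{R}}_X\log(p\kappa)),Y\mathscr{S}(\nabla^{\mathbb{R}}_Y\log(p\kappa))\rangle_F\,\kappa(X,Y)\\&\quad+4(N+1)\langle X,Y\rangle_F\,\psi'(\|X-Y\|_F^2)\,\kappa(X,Y)\\&\quad+16\psi''(\|X-Y\|_F^2)\,\langle X(X-Y),Y(X-Y)\rangle_F\,\kappa(X,Y).\end{aligned}$$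
   Context: $\langle A,B\rangle_F=\mathrm{tr}(A^\top B)$ is the Frobenius inner product, $\|\cdot\|_F$ its norm, and $\mathscr{S}(A)=(A+A^\top)/2$. $E_{ij}$ is the $N\times N$ matrix with a $1$ in entry $(i,j)$ and zeros elsewhere, $1\le i,j\le N$. The general linear group $GL(N)$ acts on $\mathcal{P}(N)$ by $G.X=G^\top XG$, and the killing field corresponding to $E_{ij}$ is $K^{ij}_X=E_{ji}X+XE_{ij}\in T_X\mathcal{P}(N)$. A kernel is real-valued, symmetric, positive semi-definite; $C^{(1,1)}$ means once continuously differentiable in each argument with continuous mixed derivative of order $(1,1)$. For a bivariate function, $K^{ij}_X$, $K^{ij}_Y$ denote $K^{ij}$ acting on the first argument $X$ and second argument $Y$. The function $\kappa_p$ is defined by $$\kappa_p(X,Y)=\kappa(X,Y)\sum_{i,j=1}^N\left[K^{ij}_X\log(p(X)\kappa(X,Y))\cdot K^{ij}_Y\log(p(Y)\kappa(X,Y))+K^{ij}_YK^{ij}_X\log\kappa(X,Y)\right].$$ The density $p$ is locally Lipschitz; derivatives of $\log p$ are set to $0$ at points of non-differentiability. For a function $f$ on a submanifold $M\subset\mathbb{R}^{N\times N}$ differentiable at $X$, a Euclidean gradient $\nabla^{\mathbb{R}}_Xf$ is any matrix in $\mathbb{R}^{N\times N}$ with $D_Xf=\langle\nabla^{\mathbb{R}}_Xf,D_X\rangle_F$ for all $D_X\in T_XM\subset\mathbb{R}^{N\times N}$ (not unique; the result holds for any choice). $\nabla^{\mathbb{R}}_X\log(p\kappa)$ is the gradient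 of $X\mapsto\log(p(X)\kappa(X,Y))$ with $Y$ fixed, and similarly $\nabla^{\mathbb{R}}_Y\log(p\kappa)$ is that of $Y\mapsto\log(p(Y)\kappa(X,Y))$ with $X$ fixed. *)

theory Defs
  imports "HOL-Analysis.Analysis"
begin

text \<open>\<open>N \<times> N\<close> matrices are \<open>real^'n^'n\<close> with \<open>N = CARD('n)\<close>.\<close>

definition frob :: "real^'n^'n \<Rightarrow> real^'n^'n \<Rightarrow> real" where
  "frob A B = trace (transpose A ** B)"

definition frob_norm :: "real^'n^'n \<Rightarrow> real" where
  "frob_norm A = sqrt (frob A A)"

definition sym_part :: "real^'n^'n \<Rightarrow> real^'n^'n" where
  "sym_part A = (1/2) *\<^sub>R (A + transpose A)"

definition Emat :: "'n \<Rightarrow> 'n \<Rightarrow> real^'n^'n" where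
  "Emat i j = (\<chi> a b. if a = i \<and> b = j then 1 else 0)"

definition spd :: "(real^'n^'n) set" where
  "spd = {X. transpose X = X \<and> (\<forall>v. v \<noteq> 0 \<longrightarrow> v \<bullet> (X *v v) > 0)}"

text \<open>The set \<open>spd\<close> is not open in the space of all matrices, so a function on it is
  differentiated with the filter \<open>at X within spd\<close>. A Frechet derivative for this filter is
  determined on tangent vectors only; \<open>frechet_derivative\<close> picks one of the admissible linear
  maps, and below it is applied to tangent vectors exclusively.\<close>

definition tangent_space :: "'a::real_normed_vector set \<Rightarrow> 'a \<Rightarrow> 'a set" where
  "tangent_space M X =
     {V. \<exists>\<gamma>::real \<Rightarrow> 'a. \<gamma> 0 = X \<and> (\<forall>t. \<gamma> t \<in> M) \<and> (\<gamma> has_vector_derivative V) (at 0)}"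

definition is_euclidean_gradient ::
    "(real^'n^'n) set \<Rightarrow> (real^'n^'n \<Rightarrow> real) \<Rightarrow> real^'n^'n \<Rightarrow> real^'n^'n \<Rightarrow> bool" where
  "is_euclidean_gradient M f X G \<longleftrightarrow>
     f differentiable (at X within M) \<and>
     (\<forall>V\<in>tangent_space M X. frechet_derivative f (at X within M) V = frob G V)"

definition killing :: "'n \<Rightarrow> 'n \<Rightarrow> real^'n^'n \<Rightarrow> real^'n^'n" where
  "killing i j X = Emat j i ** X + X ** Emat i j"

definition killing_deriv ::
    "'n \<Rightarrow> 'n \<Rightarrow> (real^'n^'n \<Rightarrow> real) \<Rightarrow> real^'n^'n \<Rightarrow> real" where
  "killing_deriv i j f X = frechet_derivative f (at X within spd) (killing i j X)"

definition kernel_on :: "'a set \<Rightarrow> ('a \<Rightarrow> 'a \<Rightarrow> real) \<Rightarrow> bool" where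
  "kernel_on M \<kappa> \<longleftrightarrow>
     (\<forall>x\<in>M. \<forall>y\<in>M. \<kappa> x y = \<kappa> y x) \<and>
     (\<forall>F c. finite F \<and> F \<subseteq> M \<longrightarrow> (\<Sum>x\<in>F. \<Sum>y\<in>F. c x * c y * \<kappa> x y) \<ge> 0)"

definition locally_lipschitz_on :: "'a::metric_space set \<Rightarrow> ('a \<Rightarrow> real) \<Rightarrow> bool" where
  "locally_lipschitz_on M f \<longleftrightarrow> (\<forall>x\<in>M. \<exists>e>0. \<exists>L. L-lipschitz_on (ball x e \<inter> M) f)"

text \<open>The directions \<open>V\<close>, \<open>W\<close> below are symmetric matrices, because every tangent space of
  \<open>spd\<close> is the space of symmetric matrices.\<close>

lemma tangent_space_spd:
  fixes X :: "real^'n^'n"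
  assumes X: "X \<in> spd"
  shows "tangent_space spd X = {V. transpose V = V}"
proof (intro set_eqI iffI)
  fix V assume "V \<in> tangent_space spd X"
  then obtain g where g: "g 0 = X" "\<And>t. g t \<in> spd" "(g has_vector_derivative V) (at 0)"
    unfolding tangent_space_def by blast
  have "linear (transpose :: real^'n^'n \<Rightarrow> real^'n^'n)"
    by (rule linearI) (simp_all add: transpose_def vec_eq_iff)
  hence lin: "bounded_linear (transpose :: real^'n^'n \<Rightarrow> real^'n^'n)"
    by (simp only: linear_conv_bounded_linear)
  have sym: "transpose (g t) = g t" for t
    using g(2)[of t] unfolding spd_def by blast
  have "((\<lambda>t. transpose (g t)) has_vector_derivative transpose V) (at 0)"
    by (rule bounded_linear.has_vector_derivative[OF lin g(3)])
  hence "(g has_vector_derivative transpose V) (at 0)"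
    by (simp only: sym)
  hence "transpose V = V"
    using g(3) by (rule vector_derivative_unique_at)
  thus "V \<in> {V. transpose V = V}" by blast
next
  fix V :: "real^'n^'n" assume "V \<in> {V. transpose V = V}"
  hence V: "transpose V = V" by simp
  let ?S = "sphere (0::real^'n) 1"
  have "axis undefined 1 \<in> ?S" by simp
  hence ne: "?S \<noteq> {}" by blast
  have cont: "continuous_on ?S (\<lambda>v. v \<bullet> (X *v v))"
    by (intro continuous_on_inner continuous_on_id linear_continuous_on
        matrix_vector_mul_bounded_linear)
  obtain v0 where v0: "v0 \<in> ?S" "\<And>v. v \<in> ?S \<Longrightarrow> v0 \<bullet> (X *v v0) \<le> v \<bullet> (X *v v)"
    using continuous_attains_inf[OF compact_sphere ne cont] by blast
  have v0_nz: "v0 \<noteq> 0" using v0(1) by auto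
  have pos: "\<forall>v. v \<noteq> 0 \<longrightarrow> v \<bullet> (X *v v) > 0" and sX: "transpose X = X"
    using X unfolding spd_def by blast+
  define c where "c = v0 \<bullet> (X *v v0)"
  have c: "c > 0" using pos v0_nz unfolding c_def by blast
  obtain B where B: "B > 0" "\<And>v. norm (V *v v) \<le> B * norm v"
    using linear_bounded_pos[OF matrix_vector_mul_linear] by blast
  have mem: "X + t *\<^sub>R V \<in> spd" if t: "\<bar>t\<bar> < c / B" for t
  proof -
    have "0 < v \<bullet> ((X + t *\<^sub>R V) *v v)" if "v \<noteq> 0" for v
    proof -
      define u where "u = (1 / norm v) *\<^sub>R v"
      have u: "norm u = 1" using that by (simp add: u_def)
      have vu: "v = norm v *\<^sub>R u" using that by (simp add: u_def)
      have "\<bar>u \<bullet> (V *v u)\<bar> \<le> norm u * norm (V *v u)" by (rule Cauchy_Schwarz_ineq2)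
      also have "\<dots> \<le> B" using B(2)[of u] u by simp
      finally have "\<bar>t * (u \<bullet> (V *v u))\<bar> \<le> \<bar>t\<bar> * B"
        by (simp add: abs_mult mult_left_mono)
      also have "\<dots> < c" using t B(1) by (simp add: pos_less_divide_eq)
      finally have "0 < u \<bullet> (X *v u) + t * (u \<bullet> (V *v u))"
        using v0(2)[of u] u unfolding c_def by simp
      also have "\<dots> = u \<bullet> ((X + t *\<^sub>R V) *v u)"
        by (simp add: matrix_vector_mult_add_rdistrib scaleR_matrix_vector_assoc[symmetric]
            inner_add_right)
      finally have "0 < (norm v)\<^sup>2 * (u \<bullet> ((X + t *\<^sub>R V) *v u))" using that by simp
      also have "\<dots> = v \<bullet> ((X + t *\<^sub>R V) *v v)"
        unfolding u_def using that by (simp add: matrix_vector_mult_scaleR power2_eq_square)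
      finally show ?thesis .
    qed
    moreover have "transpose (X + t *\<^sub>R V) = X + t *\<^sub>R V"
      using sX V by (simp add: transpose_def vec_eq_iff)
    ultimately show ?thesis unfolding spd_def by blast
  qed
  define g where "g t = (if \<bar>t\<bar> < c / B then X + t *\<^sub>R V else X)" for t
  have "((\<lambda>t. X + t *\<^sub>R V) has_vector_derivative V) (at 0)"
    by (auto intro!: derivative_eq_intros)
  moreover have "open (ball 0 (c / B) :: real set)" by simp
  moreover have "(0::real) \<in> ball 0 (c / B)" using c B(1) by simp
  moreover have "X + t *\<^sub>R V = g t" if "t \<in> ball 0 (c / B)" for t
    using that by (simp add: g_def)
  ultimately have "(g has_vector_derivative V) (at 0)"
    by (rule has_vector_derivative_transform_within_open)
  moreover have "g 0 = X" "\<forall>t. g t \<in> spd" using X mem by (auto simp: g_def)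
  ultimately show "V \<in> tangent_space spd X" unfolding tangent_space_def by blast
qed

definition C1_spd :: "(real^'n^'n \<Rightarrow> real) \<Rightarrow> bool" where
  "C1_spd f \<longleftrightarrow> f differentiable_on spd \<and>
     (\<forall>V. transpose V = V \<longrightarrow> continuous_on spd (\<lambda>X. frechet_derivative f (at X within spd) V))"

definition C11_spd :: "(real^'n^'n \<Rightarrow> real^'n^'n \<Rightarrow> real) \<Rightarrow> bool" where
  "C11_spd \<kappa> \<longleftrightarrow>
     (\<forall>Y\<in>spd. C1_spd (\<lambda>X. \<kappa> X Y)) \<and>
     (\<forall>X\<in>spd. C1_spd (\<lambda>Y. \<kappa> X Y)) \<and>
     (\<forall>V. transpose V = V \<longrightarrow>
        (\<forall>X\<in>spd. (\<lambda>Y. frechet_derivative (\<lambda>Z. \<kappa> Z Y) (at X within spd) V) differentiable_on spd) \<and>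
        (\<forall>W. transpose W = W \<longrightarrow>
           continuous_on (spd \<times> spd)
             (\<lambda>(X, Y). frechet_derivative
                (\<lambda>Y'. frechet_derivative (\<lambda>Z. \<kappa> Z Y') (at X within spd) V) (at Y within spd) W)))"

text \<open>Derivatives of \<open>log p\<close> are set to \<open>0\<close> where \<open>log p\<close> is not differentiable: when
  differentiating at such a point \<open>X\<close>, the factor \<open>p\<close> is frozen at its value \<open>p X\<close>, so that
  only \<open>log \<kappa>\<close> contributes to the derivative of \<open>log (p \<kappa>)\<close>.\<close>

definition frozen :: "(real^'n^'n \<Rightarrow> real) \<Rightarrow> real^'n^'n \<Rightarrow> real^'n^'n \<Rightarrow> real" where
  "frozen p X = (if (\<lambda>Z. ln (p Z)) differentiable (at X within spd) then p else (\<lambda>_. p X))"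

text \<open>The functions \<open>log (p \<kappa>)\<close> of the first and of the second argument, for differentiation at
  \<open>(X, Y)\<close>.\<close>

definition log_pk_fst ::
    "(real^'n^'n \<Rightarrow> real) \<Rightarrow> (real^'n^'n \<Rightarrow> real^'n^'n \<Rightarrow> real) \<Rightarrow>
     real^'n^'n \<Rightarrow> real^'n^'n \<Rightarrow> real^'n^'n \<Rightarrow> real" where
  "log_pk_fst p \<kappa> X Y = (\<lambda>Z. ln (frozen p X Z * \<kappa> Z Y))"

definition log_pk_snd ::
    "(real^'n^'n \<Rightarrow> real) \<Rightarrow> (real^'n^'n \<Rightarrow> real^'n^'n \<Rightarrow> real) \<Rightarrow>
     real^'n^'n \<Rightarrow> real^'n^'n \<Rightarrow> real^'n^'n \<Rightarrow> real" where
  "log_pk_snd p \<kappa> X Y = (\<lambda>Z. ln (frozen p Y Z * \<kappa> X Z))"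

text \<open>\<open>killing_mixed i j f X Y\<close> is \<open>K\<^sup>i\<^sup>j\<^sub>Y K\<^sup>i\<^sup>j\<^sub>X f\<close>: first along \<open>X\<close>, then along \<open>Y\<close>.\<close>

definition killing_mixed ::
    "'n \<Rightarrow> 'n \<Rightarrow> (real^'n^'n \<Rightarrow> real^'n^'n \<Rightarrow> real) \<Rightarrow> real^'n^'n \<Rightarrow> real^'n^'n \<Rightarrow> real" where
  "killing_mixed i j f X Y = killing_deriv i j (\<lambda>W. killing_deriv i j (\<lambda>Z. f Z W) X) Y"

definition kappa_p ::
    "(real^'n^'n \<Rightarrow> real) \<Rightarrow> (real^'n^'n \<Rightarrow> real^'n^'n \<Rightarrow> real) \<Rightarrow>
     real^'n^'n \<Rightarrow> real^'n^'n \<Rightarrow> real" where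
  "kappa_p p \<kappa> X Y =
     \<kappa> X Y * (\<Sum>i\<in>UNIV. \<Sum>j\<in>UNIV.
        killing_deriv i j (log_pk_fst p \<kappa> X Y) X * killing_deriv i j (log_pk_snd p \<kappa> X Y) Y
        + killing_mixed i j (\<lambda>Z W. ln (\<kappa> Z W)) X Y)"

end

theory Submission
  imports Defs
begin

text \<open>Pairing a Euclidean gradient \<open>G\<close> with the killing field \<open>K\<^sup>i\<^sup>j\<close> at a symmetric \<open>X\<close> gives twice
  the \<open>(i, j)\<close> entry of \<open>X\<close> times the symmetric part of \<open>G\<close>, so summing products of such pairings
  over \<open>i, j\<close> yields a Frobenius inner product. For a radial kernel, the chain rule turns
  \<open>K\<^sup>i\<^sup>j\<^sub>Y K\<^sup>i\<^sup>j\<^sub>X log \<kappa>\<close> into a \<open>\<psi>''\<close> term that is a product of such pairings with \<open>X - Y\<close>, and a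
  \<open>\<psi>'\<close> term whose sum is \<open>\<Sum>\<^sub>i\<^sub>j \<langle>K\<^sup>i\<^sup>j\<^sub>X, K\<^sup>i\<^sup>j\<^sub>Y\<rangle> = 2(N + 1)\<langle>X, Y\<rangle>\<close>.\<close>

section \<open>The Frobenius inner product and the algebra of killing fields\<close>

lemma frob_eq_inner: "frob A B = A \<bullet> B"
proof -
  have "frob A B = (\<Sum>i\<in>UNIV. \<Sum>k\<in>UNIV. A $ k $ i * B $ k $ i)"
    by (simp add: frob_def trace_def matrix_matrix_mult_def transpose_def)
  also have "\<dots> = (\<Sum>k\<in>UNIV. \<Sum>i\<in>UNIV. A $ k $ i * B $ k $ i)"
    by (rule sum.swap)
  finally show ?thesis by (simp add: inner_vec_def)
qed

lemma frob_eq_sum: "frob A B = (\<Sum>i\<in>UNIV. \<Sum>j\<in>UNIV. A $ i $ j * B $ i $ j)"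
  by (simp add: frob_eq_inner inner_vec_def)

lemma frob_norm_power2: "(frob_norm A)\<^sup>2 = A \<bullet> A"
  by (simp add: frob_norm_def frob_eq_inner)

lemma transpose_eq_iff_component: "transpose X = X \<longleftrightarrow> (\<forall>a b. X $ a $ b = X $ b $ a)"
  by (auto simp: transpose_def vec_eq_iff)

lemma sym_part_eq_self:
  assumes "transpose A = A"
  shows "sym_part A = A"
  using assms by (simp add: sym_part_def flip: scaleR_2)

text \<open>Left multiplication by \<open>Emat j i\<close> moves row \<open>i\<close> to row
  \<open>j\<close>; right multiplication by \<open>Emat i j\<close> moves column \<open>i\<close> to
  column \<open>j\<close>.\<close>

lemma killing_component:
  "killing i j X $ a $ b = (if a = j then X $ i $ b else 0) + (if b = j then X $ a $ i else 0)"
proof -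
  have "(\<Sum>k\<in>UNIV. (if a = j \<and> k = i then 1 else 0) * X $ k $ b) = (if a = j then X $ i $ b else 0)"
    by (simp add: if_distrib[where f = "\<lambda>x. x * _"] cong: if_cong)
  moreover have "(\<Sum>k\<in>UNIV. X $ a $ k * (if k = i \<and> b = j then 1 else 0)) = (if b = j then X $ a $ i else 0)"
    by (simp add: if_distrib[where f = "\<lambda>x. _ * x"] cong: if_cong)
  ultimately show ?thesis
    by (simp add: killing_def Emat_def matrix_matrix_mult_def)
qed

lemma killing_in_tangent_space:
  assumes "X \<in> spd"
  shows "killing i j X \<in> tangent_space spd X"
proof -
  have "transpose X = X" using assms by (simp add: spd_def)
  then have "transpose (killing i j X) = killing i j X"
    unfolding transpose_eq_iff_component by (auto simp: killing_component)
  then show ?thesis using assms by (simp add: tangent_space_spd)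
qed

text \<open>The row and column parts of the killing field pair row \<open>j\<close> and column
  \<open>j\<close> of \<open>G\<close> with row \<open>i\<close> of \<open>X\<close>. Together they
  pair that row with row \<open>j\<close> of \<open>G + transpose G\<close>, which is twice the
  symmetric part.\<close>

lemma inner_killing:
  assumes "transpose X = X"
  shows "G \<bullet> killing i j X = 2 * (X ** sym_part G) $ i $ j"
proof -
  have sym: "X $ a $ b = X $ b $ a" for a b
    using assms by (simp only: transpose_eq_iff_component)
  have "G \<bullet> killing i j X =
      (\<Sum>a\<in>UNIV. \<Sum>b\<in>UNIV. if a = j then G $ a $ b * X $ i $ b else 0)
      + (\<Sum>a\<in>UNIV. \<Sum>b\<in>UNIV. if b = j then G $ a $ b * X $ a $ i else 0)"
    unfolding inner_vec_def inner_real_def sum.distrib[symmetric]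
    by (intro sum.cong refl) (simp add: killing_component distrib_left)
  also have "(\<Sum>a\<in>UNIV. \<Sum>b\<in>UNIV. if a = j then G $ a $ b * X $ i $ b else 0)
      = (\<Sum>b\<in>UNIV. G $ j $ b * X $ i $ b)"
    by (subst sum.swap) simp
  \<comment> \<open>Symmetry of \<open>X\<close> turns its column \<open>i\<close> into row
    \<open>i\<close>, so both sums can be merged.\<close>
  also have "(\<Sum>a\<in>UNIV. \<Sum>b\<in>UNIV. if b = j then G $ a $ b * X $ a $ i else 0)
      = (\<Sum>a\<in>UNIV. G $ a $ j * X $ i $ a)"
    by (simp add: sym[of _ i])
  also have "(\<Sum>b\<in>UNIV. G $ j $ b * X $ i $ b) + (\<Sum>a\<in>UNIV. G $ a $ j * X $ i $ a)
      = 2 * (X ** sym_part G) $ i $ j"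
    by (simp add: matrix_matrix_mult_def sym_part_def transpose_def sum_distrib_left
        algebra_simps flip: sum.distrib)
  finally show ?thesis .
qed

text \<open>Serves twice: with \<open>A\<close>, \<open>B\<close> the Euclidean gradients, and with
  \<open>A = B = X - Y\<close> for the \<open>\<psi>''\<close> term.\<close>

lemma sum_inner_killing_mult:
  assumes "transpose X = X" "transpose Y = Y"
  shows "(\<Sum>i\<in>UNIV. \<Sum>j\<in>UNIV. (A \<bullet> killing i j X) * (B \<bullet> killing i j Y))
    = 4 * frob (X ** sym_part A) (Y ** sym_part B)"
  using assms by (simp add: inner_killing frob_eq_sum sum_distrib_left algebra_simps)

text \<open>Each pair \<open>(i, j)\<close> contributes twice an entry product and twice the inner
  product of the \<open>i\<close>-th rows. The latter does not depend on \<open>j\<close>, so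
  summing over \<open>j\<close> repeats it \<open>N\<close> times: hence
  \<open>N + 1\<close>.\<close>

lemma sum_inner_killing_killing:
  fixes X Y :: "real^'n^'n"
  assumes X: "transpose X = X" and Y: "transpose Y = Y"
  shows "(\<Sum>i\<in>UNIV. \<Sum>j\<in>UNIV. killing i j X \<bullet> killing i j Y)
    = 2 * (real CARD('n) + 1) * frob X Y"
proof -
  have symX: "X $ a $ b = X $ b $ a" for a b
    using X by (simp only: transpose_eq_iff_component)
  have symK: "transpose (killing i j Y) = killing i j Y" for i j
    using Y unfolding transpose_eq_iff_component by (auto simp: killing_component)
  have entry: "killing i j X \<bullet> killing i j Y
      = 2 * (X $ i $ j * Y $ i $ j) + 2 * (\<Sum>k\<in>UNIV. X $ i $ k * Y $ i $ k)" for i j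
  proof -
    \<comment> \<open>The field at \<open>Y\<close> plays the role of the gradient; being symmetric,
      it is its own symmetric part.\<close>
    have "killing i j X \<bullet> killing i j Y = 2 * (X ** killing i j Y) $ i $ j"
      using inner_killing[OF X, of "killing i j Y" i j]
      by (simp add: inner_commute sym_part_eq_self[OF symK])
    also have "(X ** killing i j Y) $ i $ j
        = (\<Sum>k\<in>UNIV. (if k = j then X $ i $ k * Y $ i $ j else 0) + X $ i $ k * Y $ k $ i)"
      unfolding matrix_matrix_mult_def
      by (simp add: killing_component distrib_left) (intro sum.cong refl; simp)
    also have "\<dots> = X $ i $ j * Y $ i $ j + (\<Sum>k\<in>UNIV. X $ i $ k * Y $ i $ k)"
      using Y by (simp add: sum.distrib transpose_eq_iff_component)
    finally show ?thesis by simp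
  qed
  show ?thesis
    unfolding entry frob_eq_sum
    by (simp add: sum.distrib sum_distrib_left[symmetric] algebra_simps)
qed

section \<open>Derivatives along killing fields\<close>

text \<open>Frechet derivatives within \<open>M\<close> need not be unique, but on a tangent vector each of them is the
  ordinary derivative of \<open>f\<close> along a curve in \<open>M\<close>.\<close>

lemma frechet_derivative_tangent:
  fixes f :: "'a::real_normed_vector \<Rightarrow> real"
  assumes f: "(f has_derivative D) (at X within M)" and V: "V \<in> tangent_space M X"
  shows "frechet_derivative f (at X within M) V = D V"
proof -
  obtain \<gamma> where \<gamma>: "\<gamma> 0 = X" "\<And>t. \<gamma> t \<in> M" "(\<gamma> has_vector_derivative V) (at 0)"
    using V unfolding tangent_space_def by blast
  have along: "((\<lambda>t. f (\<gamma> t)) has_real_derivative E V) (at 0)"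
    if E: "(f has_derivative E) (at X within M)" for E
  proof -
    \<comment> \<open>Restricting from \<open>M\<close> to the range of the curve lets the chain
      rule give a two-sided derivative at \<open>0\<close>, which is unique.\<close>
    have "(f has_derivative E) (at (\<gamma> 0) within range \<gamma>)"
      unfolding \<gamma>(1) by (rule has_derivative_subset[OF E]) (use \<gamma>(2) in blast)
    then have "((f \<circ> \<gamma>) has_derivative E \<circ> (\<lambda>t. t *\<^sub>R V)) (at 0)"
      using \<gamma>(3) unfolding has_vector_derivative_def by (intro diff_chain_within)
    moreover have "linear E" using E by (rule has_derivative_linear)
    ultimately show ?thesis
      by (simp add: has_field_derivative_def o_def linear_cmul mult_commute_abs)
  qed
  have "(f has_derivative frechet_derivative f (at X within M)) (at X within M)"
    using f frechet_derivative_works differentiable_def by blast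
  from DERIV_unique[OF along[OF this] along[OF f]] show ?thesis .
qed

text \<open>Frees \<open>killing_deriv\<close> from the choice hidden in
  \<open>frechet_derivative\<close>: any derivative computed by hand may be used.\<close>

lemma killing_deriv_eq:
  assumes "(f has_derivative D) (at X within spd)" "X \<in> spd"
  shows "killing_deriv i j f X = D (killing i j X)"
  unfolding killing_deriv_def
  using assms by (intro frechet_derivative_tangent killing_in_tangent_space)

text \<open>The squared distance takes values in \<open>{0..}\<close>, so a one-sided derivative of
  \<open>g\<close> at \<open>0\<close> is enough, even when \<open>X = A\<close>.\<close>

lemma has_derivative_radial:
  fixes g g' :: "real \<Rightarrow> real" and A :: "'a::real_inner"
  assumes "\<And>t. t \<ge> 0 \<Longrightarrow> (g has_real_derivative g' t) (at t within {0..})"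
  shows "((\<lambda>Z. g ((Z - A) \<bullet> (Z - A))) has_derivative
    (\<lambda>V. 2 * g' ((X - A) \<bullet> (X - A)) * ((X - A) \<bullet> V))) (at X within S)"
proof -
  let ?q = "\<lambda>Z. (Z - A) \<bullet> (Z - A)"
  have "(?q has_derivative (\<lambda>V. 2 * ((X - A) \<bullet> V))) (at X within S)"
    by (auto intro!: derivative_eq_intros simp: inner_commute)
  moreover have "(g has_derivative (*) (g' (?q X))) (at (?q X) within ?q ` S)"
    using assms[of "?q X"] unfolding has_field_derivative_def
    by (rule has_derivative_subset) auto
  ultimately have "((g \<circ> ?q) has_derivative (*) (g' (?q X)) \<circ> (\<lambda>V. 2 * ((X - A) \<bullet> V))) (at X within S)"
    by (rule diff_chain_within)
  then show ?thesis by (simp add: o_def mult.assoc mult.left_commute)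
qed

text \<open>The derivative in the first argument is \<open>\<psi>'\<close> times a pairing with a
  vector fixed in \<open>W\<close>. The product rule in \<open>W\<close> then yields one
  \<open>\<psi>'\<close> and one \<open>\<psi>''\<close> term.\<close>

lemma killing_mixed_radial:
  fixes \<psi> \<psi>' \<psi>'' :: "real \<Rightarrow> real" and f :: "real^'n^'n \<Rightarrow> real^'n^'n \<Rightarrow> real"
  assumes \<psi>: "\<And>t. t \<ge> 0 \<Longrightarrow> (\<psi> has_real_derivative \<psi>' t) (at t within {0..})"
    and \<psi>': "\<And>t. t \<ge> 0 \<Longrightarrow> (\<psi>' has_real_derivative \<psi>'' t) (at t within {0..})"
    and f: "\<And>Z W. Z \<in> spd \<Longrightarrow> W \<in> spd \<Longrightarrow> f Z W = - \<psi> ((Z - W) \<bullet> (Z - W))"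
    and X: "X \<in> spd" and Y: "Y \<in> spd"
  shows "killing_mixed i j f X Y =
    2 * \<psi>' ((X - Y) \<bullet> (X - Y)) * (killing i j X \<bullet> killing i j Y)
    + 4 * \<psi>'' ((X - Y) \<bullet> (X - Y)) * (((X - Y) \<bullet> killing i j X) * ((X - Y) \<bullet> killing i j Y))"
proof -
  let ?K = "killing i j X"
  \<comment> \<open>Writing \<open>W - X\<close> absorbs the minus sign of \<open>- \<psi>\<close>
    and makes the result radial in \<open>W\<close> about \<open>X\<close>, ready for a second use
    of the chain rule.\<close>
  have fst_deriv: "killing_deriv i j (\<lambda>Z. f Z W) X
      = 2 * \<psi>' ((W - X) \<bullet> (W - X)) * ((W - X) \<bullet> ?K)" if W: "W \<in> spd" for W
  proof -
    have "((\<lambda>Z. f Z W) has_derivative (\<lambda>V. - (2 * \<psi>' ((X - W) \<bullet> (X - W)) * ((X - W) \<bullet> V))))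
        (at X within spd)"
      by (rule has_derivative_transform[OF X _ has_derivative_minus[OF has_derivative_radial[OF \<psi>]]])
        (auto simp: f W)
    from killing_deriv_eq[OF this X] show ?thesis
      by (simp add: inner_diff_left inner_diff_right inner_commute algebra_simps)
  qed
  have "((\<lambda>W. 2 * \<psi>' ((W - X) \<bullet> (W - X)) * ((W - X) \<bullet> ?K)) has_derivative
      (\<lambda>V. 2 * \<psi>' ((Y - X) \<bullet> (Y - X)) * (V \<bullet> ?K)
        + 2 * (2 * \<psi>'' ((Y - X) \<bullet> (Y - X)) * ((Y - X) \<bullet> V)) * ((Y - X) \<bullet> ?K))) (at Y within spd)"
    by (auto intro!: derivative_eq_intros has_derivative_radial[OF \<psi>'])
  \<comment> \<open>The closed form is known only for \<open>W \<in> spd\<close>, which suffices for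
    a derivative within \<open>spd\<close>.\<close>
  then have "((\<lambda>W. killing_deriv i j (\<lambda>Z. f Z W) X) has_derivative
      (\<lambda>V. 2 * \<psi>' ((Y - X) \<bullet> (Y - X)) * (V \<bullet> ?K)
        + 2 * (2 * \<psi>'' ((Y - X) \<bullet> (Y - X)) * ((Y - X) \<bullet> V)) * ((Y - X) \<bullet> ?K))) (at Y within spd)"
    by (rule has_derivative_transform[OF Y, rotated]) (auto simp: fst_deriv)
  then have "killing_mixed i j f X Y = 2 * \<psi>' ((Y - X) \<bullet> (Y - X)) * (killing i j Y \<bullet> ?K)
        + 2 * (2 * \<psi>'' ((Y - X) \<bullet> (Y - X)) * ((Y - X) \<bullet> killing i j Y)) * ((Y - X) \<bullet> ?K)"
    unfolding killing_mixed_def by (rule killing_deriv_eq[OF _ Y])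
  \<comment> \<open>Back to \<open>X - Y\<close>: the signs of the two linear factors
    cancel.\<close>
  moreover have "(Y - X) \<bullet> (Y - X) = (X - Y) \<bullet> (X - Y)"
    by (simp add: inner_diff_left inner_diff_right inner_commute)
  moreover have "(Y - X) \<bullet> V = - ((X - Y) \<bullet> V)" for V
    by (simp add: inner_diff_left)
  ultimately show ?thesis by (simp add: inner_commute)
qed

section \<open>The two formulas for \<open>kappa_p\<close>\<close>

lemma killing_deriv_euclidean_gradient:
  assumes "is_euclidean_gradient spd f X G" "X \<in> spd"
  shows "killing_deriv i j f X = G \<bullet> killing i j X"
  using assms by (simp add: killing_deriv_def is_euclidean_gradient_def killing_in_tangent_space
      frob_eq_inner)

text \<open>The gradients already belong to the functions built with \<open>frozen\<close>, so no
  case split on differentiability of \<open>ln p\<close> arises.\<close>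

lemma kappa_p_euclidean_gradient:
  assumes X: "X \<in> spd" and Y: "Y \<in> spd"
    and GX: "is_euclidean_gradient spd (log_pk_fst p \<kappa> X Y) X GX"
    and GY: "is_euclidean_gradient spd (log_pk_snd p \<kappa> X Y) Y GY"
  shows "kappa_p p \<kappa> X Y =
    4 * frob (X ** sym_part GX) (Y ** sym_part GY) * \<kappa> X Y
    + (\<Sum>i\<in>UNIV. \<Sum>j\<in>UNIV. killing_mixed i j (\<lambda>Z W. ln (\<kappa> Z W)) X Y * \<kappa> X Y)"
proof -
  have "transpose X = X" "transpose Y = Y" using X Y by (simp_all add: spd_def)
  from sum_inner_killing_mult[OF this] show ?thesis
    unfolding kappa_p_def killing_deriv_euclidean_gradient[OF GX X]
      killing_deriv_euclidean_gradient[OF GY Y]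
    by (simp add: sum.distrib distrib_left flip: sum_distrib_left sum_distrib_right)
qed

text \<open>The constants are \<open>4 = 2 * 2\<close> from the sum of pairings of killing fields
  and \<open>16 = 4 * 4\<close> from the sum of products of pairings with
  \<open>X - Y\<close>.\<close>

lemma sum_killing_mixed_radial:
  fixes \<psi> \<psi>' \<psi>'' :: "real \<Rightarrow> real" and f :: "real^'n^'n \<Rightarrow> real^'n^'n \<Rightarrow> real"
  assumes "\<And>t. t \<ge> 0 \<Longrightarrow> (\<psi> has_real_derivative \<psi>' t) (at t within {0..})"
    and "\<And>t. t \<ge> 0 \<Longrightarrow> (\<psi>' has_real_derivative \<psi>'' t) (at t within {0..})"
    and "\<And>Z W. Z \<in> spd \<Longrightarrow> W \<in> spd \<Longrightarrow> f Z W = - \<psi> ((frob_norm (Z - W))\<^sup>2)"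
    and X: "X \<in> spd" and Y: "Y \<in> spd"
  shows "(\<Sum>i\<in>UNIV. \<Sum>j\<in>UNIV. killing_mixed i j f X Y) =
    4 * (real CARD('n) + 1) * frob X Y * \<psi>' ((frob_norm (X - Y))\<^sup>2)
    + 16 * \<psi>'' ((frob_norm (X - Y))\<^sup>2) * frob (X ** (X - Y)) (Y ** (X - Y))"
proof -
  have sX: "transpose X = X" and sY: "transpose Y = Y" using X Y by (simp_all add: spd_def)
  then have "transpose (X - Y) = X - Y" by (simp add: transpose_eq_iff_component)
  then have sym: "sym_part (X - Y) = X - Y" by (rule sym_part_eq_self)
  have "killing_mixed i j f X Y =
    2 * \<psi>' ((X - Y) \<bullet> (X - Y)) * (killing i j X \<bullet> killing i j Y)
    + 4 * \<psi>'' ((X - Y) \<bullet> (X - Y)) * (((X - Y) \<bullet> killing i j X) * ((X - Y) \<bullet> killing i j Y))"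
    for i j
    using assms unfolding frob_norm_power2 by (intro killing_mixed_radial) auto
  then show ?thesis
    unfolding frob_norm_power2
    by (simp add: sum.distrib sum_inner_killing_killing[OF sX sY]
        sum_inner_killing_mult[OF sX sY] sym flip: sum_distrib_left)
qed

theorem theorem5p6:
  fixes p :: "real^'n^'n \<Rightarrow> real"
    and \<kappa> :: "real^'n^'n \<Rightarrow> real^'n^'n \<Rightarrow> real"
  assumes p_pos: "\<And>X. X \<in> spd \<Longrightarrow> p X > 0"
    and p_lip: "locally_lipschitz_on spd p"
    and kernel: "kernel_on spd \<kappa>"
    and k_pos: "\<And>X Y. X \<in> spd \<Longrightarrow> Y \<in> spd \<Longrightarrow> \<kappa> X Y > 0"
    and k_C11: "C11_spd \<kappa>"
  shows "(\<forall>X\<in>spd. \<forall>Y\<in>spd. \<forall>GX GY.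
            is_euclidean_gradient spd (log_pk_fst p \<kappa> X Y) X GX \<longrightarrow>
            is_euclidean_gradient spd (log_pk_snd p \<kappa> X Y) Y GY \<longrightarrow>
            kappa_p p \<kappa> X Y =
              4 * frob (X ** sym_part GX) (Y ** sym_part GY) * \<kappa> X Y
              + (\<Sum>i\<in>UNIV. \<Sum>j\<in>UNIV. killing_mixed i j (\<lambda>Z W. ln (\<kappa> Z W)) X Y * \<kappa> X Y))
       \<and> (\<forall>\<psi> \<psi>' \<psi>'' :: real \<Rightarrow> real.
            (\<forall>t\<ge>0. (\<psi> has_real_derivative \<psi>' t) (at t within {0..})) \<longrightarrow>
            (\<forall>t\<ge>0. (\<psi>' has_real_derivative \<psi>'' t) (at t within {0..})) \<longrightarrow>
            continuous_on {0..} \<psi>'' \<longrightarrow>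
            (\<forall>X\<in>spd. \<forall>Y\<in>spd. \<kappa> X Y = exp (- \<psi> ((frob_norm (X - Y))\<^sup>2))) \<longrightarrow>
            (\<forall>X\<in>spd. \<forall>Y\<in>spd. \<forall>GX GY.
               is_euclidean_gradient spd (log_pk_fst p \<kappa> X Y) X GX \<longrightarrow>
               is_euclidean_gradient spd (log_pk_snd p \<kappa> X Y) Y GY \<longrightarrow>
               kappa_p p \<kappa> X Y =
                 4 * frob (X ** sym_part GX) (Y ** sym_part GY) * \<kappa> X Y
                 + 4 * (real CARD('n) + 1) * frob X Y * \<psi>' ((frob_norm (X - Y))\<^sup>2) * \<kappa> X Y
                 + 16 * \<psi>'' ((frob_norm (X - Y))\<^sup>2)
                     * frob (X ** (X - Y)) (Y ** (X - Y)) * \<kappa> X Y))"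
proof (intro conjI allI impI ballI)
  fix X Y :: "real^'n^'n" and GX GY
  assume "X \<in> spd" "Y \<in> spd"
    "is_euclidean_gradient spd (log_pk_fst p \<kappa> X Y) X GX"
    "is_euclidean_gradient spd (log_pk_snd p \<kappa> X Y) Y GY"
  then show "kappa_p p \<kappa> X Y =
      4 * frob (X ** sym_part GX) (Y ** sym_part GY) * \<kappa> X Y
      + (\<Sum>i\<in>UNIV. \<Sum>j\<in>UNIV. killing_mixed i j (\<lambda>Z W. ln (\<kappa> Z W)) X Y * \<kappa> X Y)"
    by (rule kappa_p_euclidean_gradient)
next
  fix \<psi> \<psi>' \<psi>'' :: "real \<Rightarrow> real" and X Y :: "real^'n^'n" and GX GY
  assume \<psi>: "\<forall>t\<ge>0. (\<psi> has_real_derivative \<psi>' t) (at t within {0..})"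
    and \<psi>': "\<forall>t\<ge>0. (\<psi>' has_real_derivative \<psi>'' t) (at t within {0..})"
    and \<kappa>: "\<forall>X\<in>spd. \<forall>Y\<in>spd. \<kappa> X Y = exp (- \<psi> ((frob_norm (X - Y))\<^sup>2))"
    and XY: "X \<in> spd" "Y \<in> spd"
    and G: "is_euclidean_gradient spd (log_pk_fst p \<kappa> X Y) X GX"
      "is_euclidean_gradient spd (log_pk_snd p \<kappa> X Y) Y GY"
  \<comment> \<open>On \<open>spd\<close> the logarithm cancels the exponential, leaving
    \<open>- \<psi>\<close> of the squared distance.\<close>
  have "(\<Sum>i\<in>UNIV. \<Sum>j\<in>UNIV. killing_mixed i j (\<lambda>Z W. ln (\<kappa> Z W)) X Y) =
      4 * (real CARD('n) + 1) * frob X Y * \<psi>' ((frob_norm (X - Y))\<^sup>2)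
      + 16 * \<psi>'' ((frob_norm (X - Y))\<^sup>2) * frob (X ** (X - Y)) (Y ** (X - Y))"
    using \<psi> \<psi>' \<kappa> XY by (intro sum_killing_mixed_radial) auto
  then show "kappa_p p \<kappa> X Y =
      4 * frob (X ** sym_part GX) (Y ** sym_part GY) * \<kappa> X Y
      + 4 * (real CARD('n) + 1) * frob X Y * \<psi>' ((frob_norm (X - Y))\<^sup>2) * \<kappa> X Y
      + 16 * \<psi>'' ((frob_norm (X - Y))\<^sup>2)
          * frob (X ** (X - Y)) (Y ** (X - Y)) * \<kappa> X Y"
    unfolding kappa_p_euclidean_gradient[OF XY G]
    by (simp add: distrib_right flip: sum_distrib_right)
qed

end
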